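(* For every fixed $d\ge 0$ there exists a constant $c=c(d)$ such that, for $G_n\sim G\big(n,\lceil d(n-1)/2\rceil\big)$, $$\Pr\big[G_n \text{ is not monotone } (c,\mathcal{S}_d,\ln^2)\text{-tiny}\big] < 200\sqrt{d/n}.$$
   Context: $G(n,m)$ is the uniform distribution on simple graphs on vertex set $[n]$ with exactly $m$ edges. For a graph $G$, $s_k(G)$ is the number of unlabeled (isomorphism classes of) $k$-vertex subgraphs of $G$. A class is tiny if it is hereditary and for some constant $\gamma$ contains at most $\gamma^n$ unlabeled $n$-vertex graphs for every $n$. For a constant $c$, a tiny class $\mathcal{Y}$ and a non-decreasing unbounded function $t$, an $n$-vertex graph $G$ is monotone $(c,\mathcal{Y},t)$-tiny if (1) for every integer $1\le k\le t(n)$, every $k$-vertex subgraph of $G$ belongs to $\mathcal{Y}$, and (2) for every integer $k$ with $t(n)<k\le n$, $s_k(G)\le c^k$. Here $\ln^2$ denotes the function $n\mapsto(\ln n)^2$. For $d\ge0$, $\mathcal{S}_d$ is the class of all graphs $G$ such that for every integer $k$ with $1000^{10(d+1)}\le k\le |V(G)|$, every $k$-vertex subgraph of $G$ has at most $k-1+k/\ln k$ edges.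
   Formalization: The formal theorem assumes d > 0 instead of d ≥ 0: for d = 0 the bound 200·sqrt(d/n) equals 0, and no probability is strictly less than 0, so the claim fails there. *)

theory Defs
  imports "HOL-Probability.Probability"
begin

text \<open>A graph is a pair (V, E): a vertex set V and a set E of 2-element subsets of V.\<close>

definition edges_on :: "nat set \<Rightarrow> nat set set" where
  "edges_on W = {e. \<exists>x y. x \<in> W \<and> y \<in> W \<and> x \<noteq> y \<and> e = {x, y}}"

definition is_subgraph :: "nat set \<times> nat set set \<Rightarrow> nat set \<times> nat set set \<Rightarrow> bool" where
  "is_subgraph H G \<longleftrightarrow> fst H \<subseteq> fst G \<and> snd H \<subseteq> snd G \<and> snd H \<subseteq> edges_on (fst H)"

definition graph_iso :: "nat set \<times> nat set set \<Rightarrow> nat set \<times> nat set set \<Rightarrow> bool" where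
  "graph_iso H H' \<longleftrightarrow> (\<exists>f. bij_betw f (fst H) (fst H') \<and>
      (\<forall>x\<in>fst H. \<forall>y\<in>fst H. {x, y} \<in> snd H \<longleftrightarrow> {f x, f y} \<in> snd H'))"

definition subgraphs_k :: "nat set \<times> nat set set \<Rightarrow> nat \<Rightarrow> (nat set \<times> nat set set) set" where
  "subgraphs_k G k = {H. is_subgraph H G \<and> card (fst H) = k}"

definition s_k :: "nat set \<times> nat set set \<Rightarrow> nat \<Rightarrow> nat" where
  "s_k G k = card ((\<lambda>H. {H' \<in> subgraphs_k G k. graph_iso H H'}) ` subgraphs_k G k)"

definition mono_tiny ::
  "real \<Rightarrow> (nat set \<times> nat set set \<Rightarrow> bool) \<Rightarrow> (real \<Rightarrow> real) \<Rightarrow> nat set \<times> nat set set \<Rightarrow> bool" where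
  "mono_tiny c Y t G \<longleftrightarrow>
     (\<forall>k::nat. 1 \<le> k \<and> real k \<le> t (real (card (fst G))) \<longrightarrow> (\<forall>H \<in> subgraphs_k G k. Y H)) \<and>
     (\<forall>k::nat. t (real (card (fst G))) < real k \<and> k \<le> card (fst G) \<longrightarrow> real (s_k G k) \<le> c ^ k)"

definition S_class :: "real \<Rightarrow> nat set \<times> nat set set \<Rightarrow> bool" where
  "S_class d G \<longleftrightarrow>
     (\<forall>k::nat. 1000 powr (10 * (d + 1)) \<le> real k \<and> k \<le> card (fst G) \<longrightarrow>
        (\<forall>H \<in> subgraphs_k G k. real (card (snd H)) \<le> real k - 1 + real k / ln (real k)))"

definition G_nm_space :: "nat \<Rightarrow> nat \<Rightarrow> nat set set set" where
  "G_nm_space n m = {E. E \<subseteq> edges_on {1..n} \<and> card E = m}"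

definition G_nm :: "nat \<Rightarrow> nat \<Rightarrow> nat set set pmf" where
  "G_nm n m = pmf_of_set (G_nm_space n m)"

end

theory Submission
  imports Defs
begin

text \<open>
  Repeatedly deleting vertices of degree at most 1 from a \<open>k\<close>-vertex graph leaves its 2-core, which has at
  least as many edges as vertices, and the deleted part is a forest hanging on the core. Listing the vertices
  in breadth-first order makes the parent function of this forest monotone, so there are at most \<open>4 ^ k\<close>
  possibilities for it. Hence \<open>s_k G k\<close> is at most \<open>4 ^ k\<close> times the number of labelled subgraphs of \<open>G\<close> on
  \<open>j \<le> k\<close> vertices with at least \<open>j\<close> edges.

  In \<open>G(n, m)\<close> a fixed set of \<open>e\<close> edges is present with probability at most \<open>(D / n) ^ e\<close> where \<open>D = d + 2\<close>, so the
  expected number of labelled \<open>k\<close>-vertex subgraphs with at least \<open>k + s\<close> edges is at most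
  \<open>exp ((1 + D / 2) * k) * (k / n) powr s\<close>. With \<open>s = 0\<close> Markov's inequality makes \<open>s_k G k > c ^ k\<close>
  exponentially unlikely in \<open>k > (ln n)\<^sup>2\<close>; with \<open>s = k / ln k - 1\<close> the expectation is at most \<open>1 / n\<^sup>2\<close> for all
  relevant \<open>k \<le> (ln n)\<^sup>2\<close>, because then \<open>n \<ge> exp (sqrt k)\<close>.
\<close>

section \<open>Unlabelled subgraphs and 2-cores\<close>

lemma edges_on_eq: "edges_on W = {e. e \<subseteq> W \<and> card e = 2}"
  unfolding edges_on_def card_2_iff by blast

lemma finite_edges_on: "finite W \<Longrightarrow> finite (edges_on W)"
  by (rule finite_subset[of _ "Pow W"]) (auto simp: edges_on_def)

lemma card_edges_on: "finite W \<Longrightarrow> card (edges_on W) = card W choose 2"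
  unfolding edges_on_eq by (rule n_subsets)

lemma edges_on_mono: "V \<subseteq> W \<Longrightarrow> edges_on V \<subseteq> edges_on W"
  by (auto simp: edges_on_def)

lemma graph_iso_sym:
  assumes "graph_iso G H"
  shows "graph_iso H G"
proof -
  from assms obtain f where f: "bij_betw f (fst G) (fst H)"
    and e: "\<And>x y. x \<in> fst G \<Longrightarrow> y \<in> fst G \<Longrightarrow> {x, y} \<in> snd G \<longleftrightarrow> {f x, f y} \<in> snd H"
    unfolding graph_iso_def by blast
  let ?g = "the_inv_into (fst G) f"
  have g: "?g x \<in> fst G" "f (?g x) = x" if "x \<in> fst H" for x
    using f that by (auto intro: bij_betw_apply[OF bij_betw_the_inv_into] f_the_inv_into_f_bij_betw)
  have "{x, y} \<in> snd H \<longleftrightarrow> {?g x, ?g y} \<in> snd G" if "x \<in> fst H" "y \<in> fst H" for x y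
    using e[of "?g x" "?g y"] g that by simp
  then show ?thesis
    unfolding graph_iso_def using bij_betw_the_inv_into[OF f] by blast
qed

lemma graph_iso_trans:
  assumes "graph_iso G H" "graph_iso H K"
  shows "graph_iso G K"
proof -
  from assms(1) obtain f where f: "bij_betw f (fst G) (fst H)"
    and ef: "\<And>x y. x \<in> fst G \<Longrightarrow> y \<in> fst G \<Longrightarrow> {x, y} \<in> snd G \<longleftrightarrow> {f x, f y} \<in> snd H"
    unfolding graph_iso_def by blast
  from assms(2) obtain g where g: "bij_betw g (fst H) (fst K)"
    and eg: "\<And>x y. x \<in> fst H \<Longrightarrow> y \<in> fst H \<Longrightarrow> {x, y} \<in> snd H \<longleftrightarrow> {g x, g y} \<in> snd K"
    unfolding graph_iso_def by blast
  have "{x, y} \<in> snd G \<longleftrightarrow> {(g \<circ> f) x, (g \<circ> f) y} \<in> snd K" if "x \<in> fst G" "y \<in> fst G" for x y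
    using ef[OF that] eg[of "f x" "f y"] bij_betwE[OF f] that by simp
  then show ?thesis
    unfolding graph_iso_def using bij_betw_trans[OF f g] by blast
qed

text \<open>A class is recovered from any code \<open>c\<close> of one of its members as the set of
  subgraphs isomorphic to \<open>rep c\<close>, so the codes cover all classes. Since
  \<open>rep c\<close> may lie outside \<open>subgraphs_k G k\<close>, codes can decode to abstract
  graphs on \<open>{..<k}\<close>.\<close>

lemma s_k_le_card_representatives:
  assumes "finite R" and "\<And>H. H \<in> subgraphs_k G k \<Longrightarrow> \<exists>c\<in>R. graph_iso H (rep c)"
  shows "s_k G k \<le> card R"
proof -
  let ?cls = "\<lambda>H. {H' \<in> subgraphs_k G k. graph_iso H H'}"
  let ?rcls = "\<lambda>c. {H' \<in> subgraphs_k G k. graph_iso (rep c) H'}"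
  have "?cls H \<in> ?rcls ` R" if H: "H \<in> subgraphs_k G k" for H
  proof -
    obtain c where "c \<in> R" "graph_iso H (rep c)"
      using assms(2)[OF H] by blast
    then have "?cls H = ?rcls c"
      using graph_iso_sym graph_iso_trans by blast
    with \<open>c \<in> R\<close> show ?thesis by blast
  qed
  then have "?cls ` subgraphs_k G k \<subseteq> ?rcls ` R" by blast
  then show ?thesis
    unfolding s_k_def
    by (meson assms(1) card_image_le card_mono finite_imageI order_trans)
qed

section \<open>Peeling a graph down to its 2-core\<close>

lemma card_le_edges_if_min_degree_2:
  assumes "finite W" "F \<subseteq> edges_on W" and "\<And>v. v \<in> W \<Longrightarrow> 2 \<le> card {e \<in> F. v \<in> e}"
  shows "card W \<le> card F"
proof -
  have fF: "finite F" using assms finite_edges_on finite_subset by blast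
  have "2 * card W = (\<Sum>v\<in>W. 2)" by simp
  also have "\<dots> \<le> (\<Sum>v\<in>W. card {e \<in> F. v \<in> e})"
    by (rule sum_mono) (use assms(3) in auto)
  \<comment> \<open>Handshake count: every edge is incident with exactly two vertices of
    \<open>W\<close>.\<close>
  also have "\<dots> = (\<Sum>e\<in>F. 2)"
  proof (rule sum_multicount_gen)
    show "\<forall>e\<in>F. card {v \<in> W. v \<in> e} = 2"
    proof
      fix e assume "e \<in> F"
      then have "e \<subseteq> W" "card e = 2" using assms(2) by (auto simp: edges_on_eq)
      then have "{v \<in> W. v \<in> e} = e" by blast
      then show "card {v \<in> W. v \<in> e} = 2" using \<open>card e = 2\<close> by simp
    qed
  qed (use assms fF in auto)
  finally show ?thesis by simp
qed

text \<open>\<open>W\<close> is the 2-core; the other vertices are peeled off one by one, a vertex \<open>v\<close> having at most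
  one neighbour \<open>p v\<close> left when it is removed (\<open>p v = v\<close> encodes that it has none).\<close>

lemma two_core_decomposition:
  assumes "finite V" "F \<subseteq> edges_on V"
  shows "\<exists>W F' p (r :: nat \<Rightarrow> nat). W \<subseteq> V \<and> F' \<subseteq> edges_on W \<and> card W \<le> card F' \<and>
    p ` V \<subseteq> V \<and> (\<forall>v\<in>W. p v = v) \<and> (\<forall>v\<in>V. p v \<noteq> v \<longrightarrow> r (p v) < r v) \<and>
    (\<forall>v\<in>V. r v \<le> card V) \<and> F = F' \<union> {{v, p v} |v. v \<in> V \<and> p v \<noteq> v}"
  using assms
proof (induction "card V" arbitrary: V F)
  case 0
  then have "V = {}" "F = {}" by (auto simp: edges_on_def)
  then show ?case by auto
next
  case (Suc n)
  show ?case
  proof (cases "\<forall>v\<in>V. 2 \<le> card {e \<in> F. v \<in> e}")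
    case True
    then have "card V \<le> card F"
      using card_le_edges_if_min_degree_2 Suc.prems by blast
    \<comment> \<open>Nothing can be peeled: the core is all of \<open>V\<close> and every vertex is
      its own parent.\<close>
    then show ?thesis
      using Suc.prems
      by - (rule exI[of _ V], rule exI[of _ F], rule exI[of _ "\<lambda>v. v"], rule exI[of _ "\<lambda>v. 0"], auto)
  next
    case False
    then obtain v where v: "v \<in> V" "card {e \<in> F. v \<in> e} < 2" by force
    let ?V = "V - {v}" and ?F = "{e \<in> F. v \<notin> e}"
    have fF: "finite F" using Suc.prems finite_edges_on finite_subset by blast
    have "n = card ?V" "finite ?V" using Suc v by auto
    moreover have "?F \<subseteq> edges_on ?V"
      using Suc.prems(2) by (auto simp: edges_on_eq)
    ultimately have ih: "\<exists>W F' p (r :: nat \<Rightarrow> nat). W \<subseteq> ?V \<and> F' \<subseteq> edges_on W \<and> card W \<le> card F' \<and>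
        p ` ?V \<subseteq> ?V \<and> (\<forall>v\<in>W. p v = v) \<and> (\<forall>v\<in>?V. p v \<noteq> v \<longrightarrow> r (p v) < r v) \<and>
        (\<forall>v\<in>?V. r v \<le> card ?V) \<and> ?F = F' \<union> {{v, p v} |v. v \<in> ?V \<and> p v \<noteq> v}"
      by (rule Suc.hyps(1))
    obtain W F' p and r :: "nat \<Rightarrow> nat" where
      W: "W \<subseteq> ?V" "F' \<subseteq> edges_on W" "card W \<le> card F'" "p ` ?V \<subseteq> ?V"
        "\<forall>w\<in>W. p w = w" "\<forall>w\<in>?V. p w \<noteq> w \<longrightarrow> r (p w) < r w"
        "\<forall>w\<in>?V. r w \<le> card ?V" and F: "?F = F' \<union> {{w, p w} |w. w \<in> ?V \<and> p w \<noteq> w}"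
      using ih by (elim exE conjE) (rule that)
    obtain u where u: "u \<in> V" "{e \<in> F. v \<in> e} = (if u = v then {} else {{v, u}})"
    proof (cases "{e \<in> F. v \<in> e} = {}")
      case True
      then show ?thesis using that[of v] v by simp
    next
      case False
      then have "card {e \<in> F. v \<in> e} = 1"
      proof -
        have "finite {e \<in> F. v \<in> e}" using fF by simp
        then have "card {e \<in> F. v \<in> e} \<noteq> 0" using False by (simp only: card_0_eq not_False_eq_True)
        then show ?thesis using v(2) by linarith
      qed
      then obtain e where e: "{e \<in> F. v \<in> e} = {e}" using card_1_singletonE by blast
      then have "e \<in> edges_on V" "v \<in> e" using Suc.prems(2) by blast+
      then obtain u where "u \<in> V" "u \<noteq> v" "e = {v, u}"
        by (auto simp: edges_on_def)
      then show ?thesis using that[of u] e by simp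
    qed
    have F_split: "F = ?F \<union> (if u = v then {} else {{v, u}})"
      using u(2) by blast
    \<comment> \<open>All earlier ranks are at most \<open>card ?V\<close>, so rank
      \<open>card V\<close> puts \<open>v\<close> above its parent. Ranks that fall along
      \<open>p\<close> certify that the parent links form a forest.\<close>
    let ?p = "p(v := u)" and ?r = "r(v := card V)"
    have rV: "card ?V < card V" using v(1) Suc.prems(1) by (meson card_Diff1_less)
    show ?thesis
    proof (rule exI[of _ W], rule exI[of _ F'], rule exI[of _ ?p], rule exI[of _ ?r], intro conjI)
      show "?p ` V \<subseteq> V" using W(4) u(1) by auto
      show "\<forall>w\<in>W. ?p w = w" using W(1,5) by auto
      show "\<forall>w\<in>V. ?p w \<noteq> w \<longrightarrow> ?r (?p w) < ?r w"
      proof (intro ballI impI)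
        fix w assume w: "w \<in> V" "?p w \<noteq> w"
        show "?r (?p w) < ?r w"
        proof (cases "w = v")
          case True
          then show ?thesis using w u(1) W(7) rV by force
        next
          case False
          then have "p w \<in> ?V" using W(4) w by blast
          then show ?thesis using False w W(6) by auto
        qed
      qed
      show "\<forall>w\<in>V. ?r w \<le> card V" using W(7) rV by force
      have "{{w, ?p w} |w. w \<in> V \<and> ?p w \<noteq> w} =
          {{w, p w} |w. w \<in> ?V \<and> p w \<noteq> w} \<union> (if u = v then {} else {{v, u}})" (is "?L = ?R")
      proof
        show "?L \<subseteq> ?R" by auto
        show "?R \<subseteq> ?L" using v(1) by (auto split: if_splits)
      qed
      then show "F = F' \<union> {{w, ?p w} |w. w \<in> V \<and> ?p w \<noteq> w}"
        using F F_split by (simp only: Un_assoc[symmetric])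
    qed (use W in auto)
  qed
qed

text \<open>Positions are processed in order; processing \<open>i\<close> appends the unlisted
  children of \<open>L ! i\<close>. Parents are thus used in list order, so the parent position
  \<open>q\<close> is monotone. Falling ranks guarantee that every vertex is reached from the roots
  in \<open>B\<close>.\<close>

lemma breadth_first_enumeration:
  fixes V :: "nat set" and p :: "nat \<Rightarrow> nat" and r :: "nat \<Rightarrow> nat"
  assumes V: "finite V" and base: "distinct B" "set B = {v \<in> V. p v = v}"
    and p: "p ` V \<subseteq> V" "\<forall>v\<in>V. p v \<noteq> v \<longrightarrow> r (p v) < r v"
  shows "\<exists>L q. distinct L \<and> set L = V \<and> length B \<le> length L \<and> take (length B) L = B \<and>
    (\<forall>l\<in>{length B..<length L}. q l < length L \<and> p (L ! l) = L ! q l) \<and>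
    mono_on {length B..<length L} q"
proof -
  \<comment> \<open>Invariant after \<open>i\<close> rounds. The bound \<open>q l < i\<close> keeps
    \<open>q\<close> monotone when new entries receive parent position \<open>i\<close>; the last
    conjunct says that all children of processed entries are listed.\<close>
  have "\<exists>L q. distinct L \<and> set L \<subseteq> V \<and> length B \<le> length L \<and> take (length B) L = B \<and>
    (\<forall>l\<in>{length B..<length L}. q l < length L \<and> q l < i \<and> p (L ! l) = L ! q l) \<and>
    mono_on {length B..<length L} q \<and>
    (\<forall>v\<in>V. \<forall>l<min i (length L). p v = L ! l \<longrightarrow> v \<in> set L)" for i :: nat
  proof (induction i)
    case 0
    show ?case
      by (intro exI[of _ B] exI[of _ "\<lambda>_. 0"]) (use base in \<open>auto simp: mono_on_def\<close>)
  next
    case (Suc i)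
    then obtain L q where L: "distinct L" "set L \<subseteq> V" "length B \<le> length L"
        "take (length B) L = B" "mono_on {length B..<length L} q"
      and q: "\<And>l. l \<in> {length B..<length L} \<Longrightarrow> q l < length L \<and> q l < i \<and> p (L ! l) = L ! q l"
      and c: "\<And>v l. v \<in> V \<Longrightarrow> l < min i (length L) \<Longrightarrow> p v = L ! l \<Longrightarrow> v \<in> set L"
      by blast
    show ?case
    proof (cases "i < length L")
      case False
      have "min (Suc i) (length L) = min i (length L)" using False by simp
      then show ?thesis
        using L q c less_SucI by (intro exI[of _ L] exI[of _ q]) (auto intro: less_SucI)
    next
      case True
      let ?C = "{v \<in> V. p v = L ! i \<and> v \<notin> set L}"
      let ?M = "L @ sorted_list_of_set ?C"
      let ?q = "\<lambda>l. if l < length L then q l else i"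
      have fC: "finite ?C" using V by simp
      have *: "?q l < length ?M \<and> ?q l < Suc i \<and> p (?M ! l) = ?M ! ?q l"
        if "l \<in> {length B..<length ?M}" for l
      proof (cases "l < length L")
        case True
        then show ?thesis using q[of l] that by (auto simp: nth_append)
      next
        case False
        then have "?M ! l \<in> set (sorted_list_of_set ?C)"
          using that by (auto simp: nth_append simp del: set_sorted_list_of_set intro!: nth_mem)
        then have "p (?M ! l) = L ! i" using fC by simp
        then show ?thesis using False True by (simp add: nth_append)
      qed
      have m: "mono_on {length B..<length ?M} ?q"
        using L(5) q by (fastforce simp: mono_on_def intro: less_imp_le)
      have cl: "v \<in> set ?M" if "v \<in> V" "l < min (Suc i) (length ?M)" "p v = ?M ! l" for v l
      proof (cases "l < i")
        case True
        then show ?thesis using c[of v l] that \<open>i < length L\<close> by (simp add: nth_append)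
      next
        case False
        then have "l = i" using that by simp
        then show ?thesis using that \<open>i < length L\<close> fC by (auto simp: nth_append)
      qed
      show ?thesis
        by (intro exI[of _ ?M] exI[of _ ?q] conjI ballI allI impI)
          (use L fC * m cl in \<open>auto\<close>)
    qed
  qed
  \<comment> \<open>\<open>L\<close> has at most \<open>card V\<close> entries, so after
    \<open>card V\<close> rounds all of them have been processed.\<close>
  from this[of "card V"] obtain L q where L: "distinct L" "set L \<subseteq> V" "length B \<le> length L"
        "take (length B) L = B" "mono_on {length B..<length L} q"
      and q: "\<And>l. l \<in> {length B..<length L} \<Longrightarrow> q l < length L \<and> p (L ! l) = L ! q l"
      and c: "\<And>v l. v \<in> V \<Longrightarrow> l < min (card V) (length L) \<Longrightarrow> p v = L ! l \<Longrightarrow> v \<in> set L"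
    by blast
  have len: "length L \<le> card V"
    using L V by (metis card_mono distinct_card)
  have "v \<in> set L" if "v \<in> V" for v
    using that
  proof (induction "r v" arbitrary: v rule: less_induct)
    case less
    show ?case
    proof (cases "p v = v")
      case True
      then have "v \<in> set B" using base less by auto
      then show ?thesis using L(4) by (metis in_set_takeD)
    next
      case False
      then have "p v \<in> set L" using less p by (metis image_subset_iff)
      then obtain l where "l < length L" "p v = L ! l" by (metis in_set_conv_nth)
      then show ?thesis using c[of v l] less len by simp
    qed
  qed
  then show ?thesis using L q by blast
qed

text \<open>A code consists of a core \<open>(W, F)\<close>, whose vertices become \<open>0, 1, \<dots>\<close> in increasing order, and a set
  \<open>S = {q l + l | l. a \<le> l < k}\<close> for the monotone parent function \<open>q\<close> of a breadth-first order. As \<open>q l + l\<close>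
  is strictly increasing, \<open>S\<close> determines both \<open>q\<close> and \<open>a = k - card S\<close>.\<close>

definition decode :: "nat \<Rightarrow> (nat set \<times> nat set set) \<times> nat set \<Rightarrow> nat set \<times> nat set set" where
  "decode k = (\<lambda>((W, F), S).
     let ws = sorted_list_of_set W; xs = sorted_list_of_set S; a = k - length xs
     in ({..<k}, {{i, j} |i j. i < card W \<and> j < card W \<and> {ws ! i, ws ! j} \<in> F} \<union>
                 {{xs ! t - (a + t), a + t} |t. t < length xs}))"

text \<open>The real excess \<open>s\<close> allows two uses: \<open>s = 0\<close> for counting
  cores, and \<open>s = k / ln k - 1\<close> for subgraphs violating the density bound of
  \<open>S_class\<close>.\<close>

definition core_pairs :: "nat set \<Rightarrow> nat \<Rightarrow> real \<Rightarrow> (nat set \<times> nat set set) set" where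
  "core_pairs U k s = {(W, F). W \<subseteq> U \<and> card W = k \<and> F \<subseteq> edges_on W \<and> real k + s \<le> real (card F)}"

text \<open>The isomorphism is indexing into a breadth-first list \<open>L\<close> of
  \<open>V\<close>. Core edges are copied from \<open>F'\<close>, and each remaining edge joins a
  position \<open>l\<close> to its parent position \<open>q l\<close>.\<close>

lemma exists_code:
  assumes V: "finite V" "card V = k" and F: "F \<subseteq> edges_on V"
  shows "\<exists>W F' S. W \<subseteq> V \<and> F' \<subseteq> F \<and> F' \<subseteq> edges_on W \<and> card W \<le> card F' \<and>
    S \<subseteq> {..<2 * k} \<and> graph_iso (V, F) (decode k ((W, F'), S))"
proof -
  obtain W F' p and r :: "nat \<Rightarrow> nat" where W: "W \<subseteq> V" "F' \<subseteq> edges_on W" "card W \<le> card F'"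
     and p: "p ` V \<subseteq> V" "\<forall>v\<in>W. p v = v" "\<forall>v\<in>V. p v \<noteq> v \<longrightarrow> r (p v) < r v"
     and F_eq: "F = F' \<union> {{v, p v} |v. v \<in> V \<and> p v \<noteq> v}"
    using two_core_decomposition[OF V(1) F] by blast
  have F_supset: "F' \<subseteq> F" and parent_edge: "\<And>v. v \<in> V \<Longrightarrow> p v \<noteq> v \<Longrightarrow> {v, p v} \<in> F"
    by (subst F_eq, blast)+
  have fW: "finite W" using W V finite_subset by blast
  define ws where "ws = sorted_list_of_set W"
  \<comment> \<open>The core comes first, in increasing order, so that positions below
    \<open>card W\<close> agree with the list that \<open>decode\<close> computes from
    \<open>W\<close>. The parentless vertices outside the core follow.\<close>
  define B where "B = ws @ sorted_list_of_set {v \<in> V - W. p v = v}"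
  have B: "distinct B" "set B = {v \<in> V. p v = v}"
    using fW V W(1) p(2) by (auto simp: B_def ws_def)
  obtain L q where L: "distinct L" "set L = V" "length B \<le> length L" "take (length B) L = B"
      and q': "\<forall>l\<in>{length B..<length L}. q l < length L \<and> p (L ! l) = L ! q l"
      and mono: "mono_on {length B..<length L} q"
    using breadth_first_enumeration[where p = p and r = r, OF V(1) B p(1,3)]
    by (elim exE conjE) (rule that)
  note q = bspec[OF q']
  define a where "a = length B"
  have k: "length L = k" using distinct_card[OF L(1)] L(2) V(2) by simp
  have ws: "length ws = card W" "distinct ws" "set ws = W" using fW by (auto simp: ws_def)
  have wa: "card W \<le> a" by (simp add: a_def B_def ws(1))
  have LB: "L ! l = B ! l" if "l < a" for l
    using nth_take[of l "length B" L] L(4) that by (simp add: a_def)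
  have Lws: "L ! l = ws ! l" if "l < card W" for l
    using LB[of l] that wa ws(1) by (simp add: B_def nth_append)
  \<comment> \<open>The vertices without a proper parent fill exactly the first \<open>a\<close>
    positions, so forest edges correspond to positions \<open>a\<close> to
    \<open>k - 1\<close>.\<close>
  have fix_iff: "p (L ! l) = L ! l \<longleftrightarrow> l < a" if "l < k" for l
  proof
    assume "l < a"
    then have "B ! l \<in> set B" by (simp add: a_def)
    then show "p (L ! l) = L ! l" using B(2) LB[OF \<open>l < a\<close>] by auto
  next
    assume "p (L ! l) = L ! l"
    moreover have "L ! l \<in> V" using L(2) k that by auto
    ultimately have "L ! l \<in> set B" using B(2) by auto
    then obtain l' where "l' < a" "L ! l = B ! l'" by (auto simp: in_set_conv_nth a_def)
    then show "l < a"
      using LB[of l'] nth_eq_iff_index_eq[OF L(1), of l' l] L(3) k that by (simp add: a_def)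
  qed
  define S where "S = (\<lambda>l. q l + l) ` {a..<k}"
  have S_list: "sorted_list_of_set S = map (\<lambda>l. q l + l) [a..<k]"
  proof (rule sorted_distinct_set_unique)
    have "q (a + i) \<le> q (a + j)" if "i < j" "j < k - a" for i j
      using mono_onD[OF mono, of "a + i" "a + j"] that k by (simp add: a_def)
    then have "sorted_wrt (<) (map (\<lambda>l. q l + l) [a..<k])"
      by (auto simp: sorted_wrt_iff_nth_less intro!: add_le_less_mono)
    then show "sorted (map (\<lambda>l. q l + l) [a..<k])" "distinct (map (\<lambda>l. q l + l) [a..<k])"
      by (auto simp: strict_sorted_iff)
  qed (auto simp: S_def)
  have cS: "card S = k - a"
    using arg_cong[OF S_list, of length] by simp
  \<comment> \<open>With \<open>a \<le> k\<close> the truncated difference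
    \<open>k - (k - a)\<close> in \<open>decode\<close> really returns \<open>a\<close>.\<close>
  have ak: "a \<le> k" using L(3) k by (simp add: a_def)
  let ?E = "{{i, j} |i j. i < card W \<and> j < card W \<and> {ws ! i, ws ! j} \<in> F'}"
  let ?P = "{{q l, l} |l. l \<in> {a..<k}}"
  \<comment> \<open>Entry \<open>t\<close> of the sorted list is \<open>q (a + t) + (a + t)\<close>,
    so the subtraction in \<open>decode\<close> returns the parent position.\<close>
  have "{{sorted_list_of_set S ! t - (a + t), a + t} |t. t < k - a} = ?P"
  proof -
    have "{sorted_list_of_set S ! t - (a + t), a + t} = {q (a + t), a + t}" if "t < k - a" for t
      using that by (simp add: S_list)
    then have "{{sorted_list_of_set S ! t - (a + t), a + t} |t. t < k - a} =
      {{q (a + t), a + t} |t. t < k - a}" by blast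
    also have "\<dots> = ?P"
    proof
      show "?P \<subseteq> {{q (a + t), a + t} |t. t < k - a}"
      proof
        fix e assume "e \<in> ?P"
        then obtain l where "e = {q l, l}" "a \<le> l" "l < k" by auto
        then have "e = {q (a + (l - a)), a + (l - a)}" "l - a < k - a" by auto
        then show "e \<in> {{q (a + t), a + t} |t. t < k - a}" by blast
      qed
    qed (fastforce)
    finally show ?thesis .
  qed
  then have dec: "decode k ((W, F'), S) = ({..<k}, ?E \<union> ?P)"
    using S_list ak cS by (simp add: decode_def Let_def ws_def)
  have "{x, y} \<in> ?E \<union> ?P \<longleftrightarrow> {L ! x, L ! y} \<in> F" if xy: "x < k" "y < k" for x y
  proof
    assume "{x, y} \<in> ?E \<union> ?P"
    then consider i j where "{x, y} = {i, j}" "i < card W" "j < card W" "{ws ! i, ws ! j} \<in> F'"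
      | l where "{x, y} = {q l, l}" "a \<le> l" "l < k" by auto
    then show "{L ! x, L ! y} \<in> F"
    proof cases
      case 1
      have "{L ! x, L ! y} = {L ! i, L ! j}"
        using arg_cong[OF 1(1), of "image ((!) L)"] by simp
      also have "\<dots> = {ws ! i, ws ! j}" using 1(2,3) by (simp add: Lws)
      finally show ?thesis using 1(4) F_supset by auto
    next
      case 2
      have "{L ! x, L ! y} = {L ! q l, L ! l}"
        using arg_cong[OF 2(1), of "image ((!) L)"] by simp
      also have "\<dots> = {L ! l, p (L ! l)}"
        using q[of l] k 2(2,3) by (simp add: a_def insert_commute)
      finally have "{L ! x, L ! y} = {L ! l, p (L ! l)}" .
      moreover have "L ! l \<in> V" "p (L ! l) \<noteq> L ! l"
        using 2 fix_iff[of l] L(2) k by auto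
      ultimately show ?thesis using parent_edge by simp
    qed
  next
    assume "{L ! x, L ! y} \<in> F"
    then have "{L ! x, L ! y} \<in> F' \<union> {{v, p v} |v. v \<in> V \<and> p v \<noteq> v}"
      by (simp only: F_eq[symmetric])
    then consider "{L ! x, L ! y} \<in> F'" | v where "{L ! x, L ! y} = {v, p v}" "v \<in> V" "p v \<noteq> v"
      by blast
    then show "{x, y} \<in> ?E \<union> ?P"
    proof cases
      case 1
      have idx: "z < card W" if "z < k" "L ! z \<in> W" for z
      proof -
        have "L ! z \<in> set ws" using that ws(3) by simp
        then obtain i where "i < card W" "ws ! i = L ! z" using ws(1) by (auto simp: in_set_conv_nth)
        then show ?thesis
          using Lws[of i] nth_eq_iff_index_eq[OF L(1), of i z] k that wa ak by auto
      qed
      have "L ! x \<in> W" "L ! y \<in> W" using 1 W(2) by (auto simp: edges_on_eq)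
      then have "x < card W" "y < card W" using idx xy by auto
      moreover have "{ws ! x, ws ! y} \<in> F'" using 1 Lws calculation by simp
      ultimately show ?thesis by blast
    next
      case 2
      then obtain l where l: "l < k" "v = L ! l" using k by (auto simp: in_set_conv_nth L(2)[symmetric])
      then have "a \<le> l" using 2 fix_iff[of l] by simp
      then have ql: "q l < k" "p v = L ! q l" using q[of l] l k by (auto simp: a_def)
      have "{L ! x, L ! y} = {L ! q l, L ! l}" using 2(1) l(2) ql(2) by (simp add: insert_commute)
      then have "{x, y} = {q l, l}"
        using k xy l(1) ql(1) by (simp add: doubleton_eq_iff nth_eq_iff_index_eq[OF L(1)])
      moreover have "l \<in> {a..<k}" using l(1) \<open>a \<le> l\<close> by simp
      ultimately show ?thesis by blast
    qed
  qed
  moreover have "bij_betw ((!) L) {..<k} V"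
    using L(1,2) k by (simp add: bij_betw_nth)
  ultimately have "graph_iso (decode k ((W, F'), S)) (V, F)"
    unfolding dec graph_iso_def by auto
  then have "graph_iso (V, F) (decode k ((W, F'), S))" by (rule graph_iso_sym)
  moreover have "S \<subseteq> {..<2 * k}"
  proof
    fix x assume "x \<in> S"
    then obtain l where "x = q l + l" "a \<le> l" "l < k" by (auto simp: S_def)
    then show "x \<in> {..<2 * k}" using q[of l] k by (auto simp: a_def)
  qed
  ultimately show ?thesis
    using W F_supset by - (rule exI[of _ W], rule exI[of _ F'], rule exI[of _ S], intro conjI)
qed

lemma core_pairs_subset: "core_pairs U k s \<subseteq> Pow U \<times> Pow (edges_on U)"
proof clarsimp
  fix W F assume "(W, F) \<in> core_pairs U k s"
  then have "W \<subseteq> U" "F \<subseteq> edges_on W" by (auto simp: core_pairs_def)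
  then show "W \<subseteq> U \<and> F \<subseteq> edges_on U" using edges_on_mono by (meson order_trans)
qed

lemma finite_core_pairs: "finite U \<Longrightarrow> finite (core_pairs U k s)"
  by (rule finite_subset[OF core_pairs_subset]) (simp add: finite_edges_on)

text \<open>Every \<open>k\<close>-vertex subgraph has a code whose core lies in \<open>E\<close>
  and has \<open>j \<le> k\<close> vertices and at least \<open>j\<close> edges. The forest part is
  one of the \<open>2 ^ (2 * k) = 4 ^ k\<close> subsets of \<open>{..<2 * k}\<close>.\<close>

lemma s_k_le_core_pairs:
  assumes "finite U"
  shows "s_k (U, E) k \<le> 4 ^ k * card {c \<in> (\<Union>j\<le>k. core_pairs U j 0). snd c \<subseteq> E}"
proof -
  let ?C = "{c \<in> (\<Union>j\<le>k. core_pairs U j 0). snd c \<subseteq> E}"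
  have fC: "finite ?C" using finite_core_pairs[OF assms] by simp
  have "s_k (U, E) k \<le> card (?C \<times> Pow {..<2 * k})"
  proof (rule s_k_le_card_representatives)
    show "finite (?C \<times> Pow {..<2 * k})" using fC by simp
    fix H assume "H \<in> subgraphs_k (U, E) k"
    then have H: "fst H \<subseteq> U" "snd H \<subseteq> E" "snd H \<subseteq> edges_on (fst H)" "card (fst H) = k"
      by (auto simp: subgraphs_k_def is_subgraph_def)
    have fH: "finite (fst H)" using H(1) assms finite_subset by blast
    obtain W F' S where W: "W \<subseteq> fst H" "F' \<subseteq> snd H" "F' \<subseteq> edges_on W" "card W \<le> card F'"
       "S \<subseteq> {..<2 * k}" "graph_iso H (decode k ((W, F'), S))"
      using exists_code[OF fH H(4,3)] by auto
    have "card W \<le> k" using W(1) H(4) fH card_mono by blast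
    then have "((W, F'), S) \<in> ?C \<times> Pow {..<2 * k}"
      using W H by (auto simp: core_pairs_def)
    then show "\<exists>c\<in>?C \<times> Pow {..<2 * k}. graph_iso H (decode k c)"
      using W(6) by blast
  qed
  also have "\<dots> = card ?C * 2 ^ (2 * k)"
    by (simp add: card_cartesian_product card_Pow)
  also have "\<dots> = 4 ^ k * card ?C" by (simp add: power_mult)
  finally show ?thesis .
qed

section \<open>First moments in the uniform random graph\<close>

text \<open>Markov's inequality for the number of members of \<open>C\<close> whose edges lie in
  \<open>E\<close>. Here \<open>x\<close> is an upper bound for the edge density, and a fixed edge
  set \<open>F\<close> is present with probability at most \<open>x ^ card F\<close>.\<close>

lemma prob_G_nm_le_first_moment:
  fixes t x :: real
  assumes t: "t > 0" and x: "x \<ge> 0" and C: "finite C" "\<And>c. c \<in> C \<Longrightarrow> snd c \<subseteq> edges_on {1..n}"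
    and m: "m \<le> n choose 2" "real m \<le> x * real (n choose 2)"
    and A: "\<And>E. E \<in> A \<Longrightarrow> E \<in> G_nm_space n m \<Longrightarrow> t \<le> real (card {c \<in> C. snd c \<subseteq> E})"
  shows "measure_pmf.prob (G_nm n m) A \<le> (\<Sum>c\<in>C. x ^ card (snd c)) / t"
proof -
  let ?S = "G_nm_space n m"
  have fe: "finite (edges_on {1..n})" by (simp add: finite_edges_on)
  have cS: "card ?S = (n choose 2) choose m"
    using n_subsets[OF fe] by (simp add: G_nm_space_def card_edges_on)
  then have posS: "card ?S > 0" using m(1) by simp
  then have fS: "finite ?S" "?S \<noteq> {}" using card_gt_0_iff by blast+
  have contain: "real (card {E \<in> ?S. F \<subseteq> E}) \<le> x ^ card F * real (card ?S)"
    if F: "F \<subseteq> edges_on {1..n}" for F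
  proof (cases "card F \<le> m")
    case False
    have "{E \<in> ?S. F \<subseteq> E} = {}"
      using False fe by (auto simp: G_nm_space_def dest: card_mono[rotated] finite_subset)
    then show ?thesis using x by (simp only: card.empty) simp
  next
    case True
    have fF: "finite F" using F fe finite_subset by blast
    let ?R = "{D. D \<subseteq> edges_on {1..n} - F \<and> card D = m - card F}"
    have "bij_betw (\<lambda>D. D \<union> F) ?R {E \<in> ?S. F \<subseteq> E}"
    proof (rule bij_betw_byWitness[where f' = "\<lambda>E. E - F"])
      show "(\<lambda>D. D \<union> F) ` ?R \<subseteq> {E \<in> ?S. F \<subseteq> E}"
      proof clarify
        fix D assume D: "D \<subseteq> edges_on {1..n} - F" "card D = m - card F"
        then have "finite D" "D \<inter> F = {}" using fe finite_subset by blast+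
        then have "card (D \<union> F) = m" using D True fF by (simp add: card_Un_disjoint)
        then show "D \<union> F \<in> ?S \<and> F \<subseteq> D \<union> F" using D F by (auto simp: G_nm_space_def)
      qed
      show "(\<lambda>E. E - F) ` {E \<in> ?S. F \<subseteq> E} \<subseteq> ?R"
        using fF by (auto simp: G_nm_space_def card_Diff_subset)
    qed auto
    then have "card {E \<in> ?S. F \<subseteq> E} = card ?R" by (simp add: bij_betw_same_card)
    also have "\<dots> = ((n choose 2) - card F) choose (m - card F)"
      using fe F fF by (subst n_subsets) (auto simp: card_Diff_subset card_edges_on)
    finally have card_eq: "card {E \<in> ?S. F \<subseteq> E} = ((n choose 2) - card F) choose (m - card F)" .
    \<comment> \<open>The ratio of the two binomials is the product of
      \<open>(m - i) / (N - i)\<close> over \<open>i < f\<close>, and each factor is at most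
      \<open>x\<close>.\<close>
    have "real ((N - f) choose (m - f)) \<le> x ^ f * real (N choose m)"
      if "f \<le> m" "m \<le> N" "real m \<le> x * real N" for f N
      using that(1)
    proof (induction f)
      case 0
      then show ?case by simp
    next
      case (Suc f)
      \<comment> \<open>The density bound \<open>x\<close> may exceed 1; then
        \<open>m \<le> N\<close> alone suffices.\<close>
      have step: "real (m - f) \<le> x * real (N - f)"
      proof (cases "x \<le> 1")
        case True
        then have "x * real f \<le> real f" by (simp add: mult_left_le_one_le x)
        then show ?thesis using Suc.prems that by (simp add: of_nat_diff algebra_simps)
      next
        case False
        then have "real (N - f) \<le> x * real (N - f)" by (simp add: mult_le_cancel_right1)
        then show ?thesis using that Suc.prems by linarith
      qed
      have "(m - f) * ((N - f) choose (m - f)) = (N - f) * ((N - f - 1) choose (m - f - 1))"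
        using Suc.prems by (intro times_binomial_minus1_eq) simp
      then have "real (N - f) * real ((N - Suc f) choose (m - Suc f)) =
          real (m - f) * real ((N - f) choose (m - f))"
        by (metis (no_types) diff_Suc_eq_diff_pred diff_commute of_nat_mult diff_diff_left plus_1_eq_Suc Suc_eq_plus1)
      also have "\<dots> \<le> (x * real (N - f)) * (x ^ f * real (N choose m))"
        by (rule mult_mono[OF step Suc.IH]) (use Suc.prems x in auto)
      finally have "real (N - f) * real ((N - Suc f) choose (m - Suc f)) \<le>
          real (N - f) * (x ^ Suc f * real (N choose m))" by (simp add: mult_ac)
      moreover have "real (N - f) > 0" using Suc.prems that by simp
      ultimately show ?case by (simp only: mult_le_cancel_left_pos)
    qed
    from this[OF True m] show ?thesis using card_eq cS by simp
  qed
  let ?X = "\<lambda>E. card {c \<in> C. snd c \<subseteq> E}"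
  have "real (card (?S \<inter> A)) * t = (\<Sum>E\<in>?S \<inter> A. t)" by simp
  also have "\<dots> \<le> (\<Sum>E\<in>?S \<inter> A. real (?X E))" using A by (intro sum_mono) auto
  also have "\<dots> \<le> (\<Sum>E\<in>?S. real (?X E))" using fS by (intro sum_mono2) auto
  also have "\<dots> = real (\<Sum>E\<in>?S. ?X E)" by simp
  \<comment> \<open>Double counting of pairs of a graph and a member of \<open>C\<close> contained
    in it.\<close>
  also have "(\<Sum>E\<in>?S. ?X E) = (\<Sum>c\<in>C. card {E \<in> ?S. snd c \<subseteq> E})"
    using fS C by (intro sum_multicount_gen) auto
  also have "real \<dots> = (\<Sum>c\<in>C. real (card {E \<in> ?S. snd c \<subseteq> E}))" by simp
  also have "\<dots> \<le> (\<Sum>c\<in>C. x ^ card (snd c) * real (card ?S))"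
    using contain C by (intro sum_mono) auto
  also have "\<dots> = (\<Sum>c\<in>C. x ^ card (snd c)) * real (card ?S)" by (simp add: sum_distrib_right)
  finally have "real (card (?S \<inter> A)) / real (card ?S) \<le> (\<Sum>c\<in>C. x ^ card (snd c)) / t"
    using t posS by (simp add: field_simps)
  then show ?thesis
    unfolding G_nm_def using measure_pmf_of_set[OF fS(2,1)] by simp
qed

section \<open>Expected numbers of labelled subgraphs with many edges\<close>

lemma power_div_fact_le_exp:
  fixes x :: real
  assumes "x \<ge> 0"
  shows "x ^ k / fact k \<le> exp x"
proof -
  have "(\<Sum>n\<in>{k}. x ^ n /\<^sub>R fact n) \<le> (\<Sum>n. x ^ n /\<^sub>R fact n)"
    using assms by (intro sum_le_suminf summable_exp_generic) auto
  then show ?thesis by (simp add: exp_def divide_inverse mult.commute)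
qed

lemma sum_Pow_power_card:
  fixes y :: "'a :: comm_ring_1"
  assumes "finite A"
  shows "(\<Sum>F\<in>Pow A. y ^ card F) = (1 + y) ^ card A"
proof -
  have "(1 + y) ^ card A = (\<Prod>i\<in>A. y + 1)" by (simp add: add.commute)
  also have "\<dots> = (\<Sum>F\<in>Pow A. y ^ card F)"
    using assms by (subst prod_add) auto
  finally show ?thesis by simp
qed

text \<open>The terms with at least \<open>k + s\<close> edges are extracted by the weight \<open>(n / k) powr (card F - k - s) \<ge> 1\<close>.\<close>

lemma core_pairs_first_moment:
  fixes D s :: real
  assumes k: "1 \<le> k" "k \<le> n" and D: "D \<ge> 0"
  shows "(\<Sum>c\<in>core_pairs {1..n} k s. (D / real n) ^ card (snd c)) \<le>
    exp ((1 + D / 2) * real k) * (real k / real n) powr s"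
proof -
  define z where "z = real k / real n"
  have z: "0 < z" "z \<le> 1" using k by (auto simp: z_def)
  let ?x = "D / real n"
  let ?Ws = "{W. W \<subseteq> {1..n} \<and> card W = k}"
  let ?Fs = "\<lambda>W. {F. F \<subseteq> edges_on W \<and> real k + s \<le> real (card F)}"
  have fW: "finite W" if "W \<in> ?Ws" for W using that finite_subset by blast
  have inner: "(\<Sum>F\<in>?Fs W. ?x ^ card F) \<le> z ^ k * z powr s * exp (D / 2 * real k)" if W: "W \<in> ?Ws" for W
  proof -
    have fe: "finite (edges_on W)" using fW[OF W] finite_edges_on by blast
    have "(\<Sum>F\<in>?Fs W. ?x ^ card F) \<le> (\<Sum>F\<in>?Fs W. z powr (real k + s) * (D / real k) ^ card F)"
    proof (rule sum_mono)
      fix F assume F: "F \<in> ?Fs W"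
      \<comment> \<open>Split \<open>D / n\<close> as \<open>z * (D / k)\<close>; as
        \<open>z \<le> 1\<close>, lowering its exponent to \<open>k + s\<close> only enlarges the
        term.\<close>
      have "?x ^ card F = z powr real (card F) * (D / real k) ^ card F"
        using z k by (simp add: powr_realpow power_mult_distrib[symmetric] z_def)
      also have "\<dots> \<le> z powr (real k + s) * (D / real k) ^ card F"
        using F z D by (intro mult_right_mono powr_mono') auto
      finally show "?x ^ card F \<le> z powr (real k + s) * (D / real k) ^ card F" .
    qed
    \<comment> \<open>Without the edge constraint the sum is evaluated by the binomial
      theorem.\<close>
    also have "\<dots> \<le> (\<Sum>F\<in>Pow (edges_on W). z powr (real k + s) * (D / real k) ^ card F)"
      using fe D by (intro sum_mono2) auto
    also have "\<dots> = z powr (real k + s) * (1 + D / real k) ^ (k choose 2)"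
      using fe W fW[OF W] by (simp add: sum_distrib_left[symmetric] sum_Pow_power_card card_edges_on)
    also have "\<dots> \<le> z powr (real k + s) * exp (D / 2 * real k)"
    proof (rule mult_left_mono)
      have "k choose 2 = k * (k - 1) div 2" by (rule choose_two)
      also have "\<dots> \<le> k * k div 2" by (intro div_le_mono) simp
      finally have "real (k choose 2) \<le> real k * real k / 2" by (simp flip: of_nat_mult)
      then have "real (k choose 2) * (D / real k) \<le> real k * real k / 2 * (D / real k)"
        by (rule mult_right_mono) (use D in simp)
      also have "\<dots> = D / 2 * real k" using k by simp
      finally have exponent: "real (k choose 2) * (D / real k) \<le> D / 2 * real k" .
      have "(1 + D / real k) ^ (k choose 2) \<le> exp (D / real k) ^ (k choose 2)"
        using D by (intro power_mono) auto
      also have "\<dots> = exp (real (k choose 2) * (D / real k))"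
        by (rule exp_of_nat_mult[symmetric])
      also have "\<dots> \<le> exp (D / 2 * real k)"
        using exponent by (simp only: exp_le_cancel_iff)
      finally show "(1 + D / real k) ^ (k choose 2) \<le> exp (D / 2 * real k)" .
    qed simp
    also have "\<dots> = z ^ k * z powr s * exp (D / 2 * real k)"
      using z by (simp add: powr_add powr_realpow)
    finally show ?thesis .
  qed
  have sigma: "core_pairs {1..n} k s = (SIGMA W:?Ws. ?Fs W)" by (auto simp: core_pairs_def)
  have "finite ?Ws" by simp
  moreover have "\<forall>W\<in>?Ws. finite (?Fs W)" using fW finite_edges_on by simp
  ultimately have "(\<Sum>W\<in>?Ws. \<Sum>F\<in>?Fs W. ?x ^ card F) =
      (\<Sum>(W, F)\<in>(SIGMA W:?Ws. ?Fs W). ?x ^ card F)"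
    by (rule sum.Sigma)
  then have "(\<Sum>c\<in>core_pairs {1..n} k s. ?x ^ card (snd c)) = (\<Sum>W\<in>?Ws. \<Sum>F\<in>?Fs W. ?x ^ card F)"
    unfolding sigma by (simp only: case_prod_unfold)
  also have "\<dots> \<le> (\<Sum>W\<in>?Ws. z ^ k * z powr s * exp (D / 2 * real k))"
    by (rule sum_mono) (rule inner)
  also have "\<dots> = (real (n choose k) * z ^ k) * (z powr s * exp (D / 2 * real k))"
    using n_subsets[of "{1..n}" k] by simp
  \<comment> \<open>The factor \<open>z ^ k\<close> cancels \<open>n ^ k\<close> in the binomial
    bound, leaving \<open>k ^ k / fact k\<close>, a single term of the series for
    \<open>exp k\<close>.\<close>
  also have "\<dots> \<le> exp (real k) * (z powr s * exp (D / 2 * real k))"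
  proof (rule mult_right_mono)
    have "real (n choose k) * fact k \<le> real n ^ k"
      using binomial_fact_pow[of n k] by (metis of_nat_fact of_nat_le_iff of_nat_mult of_nat_power)
    then have "real (n choose k) * z ^ k \<le> real n ^ k / fact k * z ^ k"
      using z by (intro mult_right_mono) (auto simp: field_simps)
    also have "\<dots> = real k ^ k / fact k" using k by (simp add: z_def power_divide)
    also have "\<dots> \<le> exp (real k)" by (rule power_div_fact_le_exp) simp
    finally show "real (n choose k) * z ^ k \<le> exp (real k)" .
  qed simp
  also have "\<dots> = exp ((1 + D / 2) * real k) * (real k / real n) powr s"
    by (simp add: z_def distrib_right exp_add)
  finally show ?thesis .
qed

section \<open>Tail estimates\<close>

lemma prob_dense_subgraph_le:
  fixes D s :: real
  assumes k: "1 \<le> k" "k \<le> n" and D: "D \<ge> 0"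
    and m: "m \<le> n choose 2" "real m \<le> D / real n * real (n choose 2)"
  shows "measure_pmf.prob (G_nm n m)
      {E. \<exists>H\<in>subgraphs_k ({1..n}, E) k. real k + s \<le> real (card (snd H))} \<le>
    exp ((1 + D / 2) * real k) * (real k / real n) powr s"
proof -
  let ?C = "core_pairs {1..n} k s"
  have fC: "finite ?C" by (simp add: finite_core_pairs)
  have "measure_pmf.prob (G_nm n m)
      {E. \<exists>H\<in>subgraphs_k ({1..n}, E) k. real k + s \<le> real (card (snd H))} \<le>
    (\<Sum>c\<in>?C. (D / real n) ^ card (snd c)) / 1"
  proof (rule prob_G_nm_le_first_moment)
    fix E assume "E \<in> {E. \<exists>H\<in>subgraphs_k ({1..n}, E) k. real k + s \<le> real (card (snd H))}"
    then obtain H where H: "H \<in> subgraphs_k ({1..n}, E) k" "real k + s \<le> real (card (snd H))"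
      by blast
    then have "H \<in> {c \<in> ?C. snd c \<subseteq> E}"
      by (auto simp: core_pairs_def subgraphs_k_def is_subgraph_def case_prod_unfold)
    then have "{c \<in> ?C. snd c \<subseteq> E} \<noteq> {}" by blast
    then have "card {c \<in> ?C. snd c \<subseteq> E} \<noteq> 0" using fC by simp
    then show "1 \<le> real (card {c \<in> ?C. snd c \<subseteq> E})" by simp
  next
    fix c assume "c \<in> ?C"
    then show "snd c \<subseteq> edges_on {1..n}" by (auto dest!: subsetD[OF core_pairs_subset])
  qed (use D m fC in auto)
  then show ?thesis using core_pairs_first_moment[OF k D, of s] by simp
qed

text \<open>More than \<open>c ^ k\<close> classes force at least \<open>(c / 4) ^ k\<close> cores,
  by the coding bound. The constant 8 is this 4 times a 2 that absorbs the \<open>k + 1\<close>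
  possible core sizes.\<close>

lemma prob_many_unlabelled_subgraphs_le:
  fixes D c :: real
  assumes k: "1 \<le> k" "k \<le> n" and D: "D \<ge> 0" and c: "c > 0"
    and m: "m \<le> n choose 2" "real m \<le> D / real n * real (n choose 2)"
  shows "measure_pmf.prob (G_nm n m) {E. c ^ k < real (s_k ({1..n}, E) k)} \<le>
    (8 * exp (1 + D / 2) / c) ^ k"
proof -
  let ?U = "{1..n}" and ?w = "\<lambda>c. (D / real n) ^ card (snd c)"
  let ?C = "\<Union>j\<le>k. core_pairs ?U j 0"
  have fC: "finite ?C" by (simp add: finite_core_pairs)
  have "measure_pmf.prob (G_nm n m) {E. c ^ k < real (s_k (?U, E) k)} \<le>
    (\<Sum>c\<in>?C. ?w c) / (c / 4) ^ k"
  proof (rule prob_G_nm_le_first_moment)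
    fix E assume E: "E \<in> {E. c ^ k < real (s_k (?U, E) k)}"
    have "real (s_k (?U, E) k) \<le> real (4 ^ k * card {c \<in> ?C. snd c \<subseteq> E})"
      using s_k_le_core_pairs[of ?U E k] by (simp only: of_nat_le_iff finite_atLeastAtMost)
    then have "c ^ k \<le> 4 ^ k * real (card {c \<in> ?C. snd c \<subseteq> E})" using E by simp
    then show "(c / 4) ^ k \<le> real (card {c \<in> ?C. snd c \<subseteq> E})"
      by (simp add: power_divide field_simps)
  next
    fix x assume "x \<in> ?C"
    then show "snd x \<subseteq> edges_on ?U" by (auto dest!: subsetD[OF core_pairs_subset])
  qed (use D m fC c in auto)
  also have "(\<Sum>c\<in>?C. ?w c) \<le> (2 * exp (1 + D / 2)) ^ k"
  proof -
    have term_le: "(\<Sum>c\<in>core_pairs ?U j 0. ?w c) \<le> exp ((1 + D / 2) * real k)" if "j \<le> k" for j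
    proof (cases "j = 0")
      case True
      have "core_pairs ?U j 0 = {({}, {})}"
        using True by (auto simp: core_pairs_def edges_on_def dest: finite_subset[OF _ finite_atLeastAtMost])
      then show ?thesis using D by simp
    next
      case False
      have "(\<Sum>c\<in>core_pairs ?U j 0. ?w c) \<le> exp ((1 + D / 2) * real j)"
        using core_pairs_first_moment[of j n D 0] False that k D by simp
      also have "\<dots> \<le> exp ((1 + D / 2) * real k)" using that D by (simp add: mult_left_mono)
      finally show ?thesis .
    qed
    have "(\<Sum>c\<in>?C. ?w c) = (\<Sum>j\<le>k. \<Sum>c\<in>core_pairs ?U j 0. ?w c)"
      by (rule sum.UNION_disjoint) (auto simp: finite_core_pairs, auto simp: core_pairs_def)
    also have "\<dots> \<le> (\<Sum>j\<le>k. exp ((1 + D / 2) * real k))"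
      by (rule sum_mono) (use term_le in auto)
    also have "\<dots> = real (Suc k) * exp ((1 + D / 2) * real k)" by simp
    also have "\<dots> \<le> 2 ^ k * exp ((1 + D / 2) * real k)"
    proof (rule mult_right_mono)
      have "Suc k \<le> 2 ^ k" unfolding Suc_le_eq by (rule less_exp)
      then show "real (Suc k) \<le> 2 ^ k" by (metis of_nat_le_iff of_nat_numeral of_nat_power)
    qed simp
    also have "exp ((1 + D / 2) * real k) = exp (1 + D / 2) ^ k"
      by (subst exp_of_nat2_mult[symmetric]) simp
    finally show ?thesis by (simp add: power_mult_distrib)
  qed
  also have "(2 * exp (1 + D / 2)) ^ k / (c / 4) ^ k = (8 * exp (1 + D / 2) / c) ^ k"
    unfolding power_divide[symmetric] by simp
  finally show ?thesis using c by (simp add: divide_right_mono)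
qed

text \<open>Writing \<open>k = w ^ 4\<close> turns the later estimate into a polynomial one in
  \<open>w\<close>. The bound on \<open>w\<close> comes from \<open>v = 1000 powr (d + 1)\<close>:
  it satisfies \<open>v ^ 4 \<le> v ^ 10 \<le> k\<close>, and \<open>1 + d \<le> exp d\<close> gives
  \<open>1000 * (d + 1) \<le> v\<close>.\<close>

lemma threshold_fourth_root:
  fixes d k :: real
  assumes "d \<ge> 0" "1000 powr (10 * (d + 1)) \<le> k"
  shows "\<exists>w \<ge> 1000 * (d + 1). k = w ^ 4"
proof -
  have e1: "exp (1::real) \<le> 1000" using exp_le by linarith
  have "1 + d \<le> exp d" by (rule exp_ge_add_one_self)
  also have "\<dots> = exp 1 powr d" by (simp add: powr_def)
  also have "\<dots> \<le> 1000 powr d" using e1 assms(1) by (intro powr_mono2) auto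
  finally have v: "1000 * (d + 1) \<le> 1000 powr (d + 1)" by (simp add: powr_add)
  define v where "v = (1000::real) powr (d + 1)"
  have "1 \<le> v" using v assms(1) by (simp add: v_def)
  then have "v ^ 4 \<le> v ^ 10" by (intro power_increasing) auto
  also have "v ^ 10 = 1000 powr (10 * (d + 1))"
    unfolding v_def by (simp add: powr_powr[symmetric] powr_realpow[symmetric] powr_powr mult.commute)
  finally have "v ^ 4 \<le> k" using assms(2) by simp
  moreover have k0: "0 \<le> k" using assms(2) powr_ge_zero[of 1000 "10 * (d + 1)"] by linarith
  ultimately have "v \<le> root 4 k"
    using \<open>1 \<le> v\<close> by (metis linorder_not_less not_numeral_less_one order_less_imp_le order_trans real_root_le_iff real_root_power_cancel zero_less_numeral zero_le_one)
  then show ?thesis using v k0 by (intro exI[of _ "root 4 k"]) (auto simp: v_def)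
qed

text \<open>With \<open>a = ln k\<close> and \<open>b = ln n\<close> the left side is
  \<open>exp ((2 + d / 2) * k + \<sigma> * (a - b))\<close>. Since \<open>b \<ge> w\<^sup>2\<close>
  dominates \<open>a \<le> 4 * w\<close>, the second summand is at most
  \<open>- \<sigma> * b / 2\<close>, and \<open>\<sigma>\<close> is of order at least
  \<open>w ^ 3\<close>.\<close>

lemma dense_subgraph_bound_le:
  fixes d :: real and k n :: nat
  assumes d: "d \<ge> 0" and k: "1000 powr (10 * (d + 1)) \<le> real k" "real k \<le> (ln (real n))\<^sup>2"
    and n: "n \<ge> 1"
  shows "exp ((2 + d / 2) * real k) * (real k / real n) powr (real k / ln (real k) - 1) \<le> 1 / (real n)\<^sup>2"
proof -
  obtain w where w: "1000 * (d + 1) \<le> w" and kw: "real k = w ^ 4"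
    using threshold_fourth_root[OF d k(1)] by blast
  have w1000: "w \<ge> 1000" using w d by argo
  define a where "a = ln (real k)"
  define b where "b = ln (real n)"
  define \<sigma> where "\<sigma> = real k / a - 1"
  have kpos: "real k > 0" using kw w1000 by simp
  have a_eq: "a = 4 * ln w" using w1000 by (simp add: a_def kw ln_realpow)
  have lnw: "ln w \<le> w" "ln w > 0" using ln_le_minus_one[of w] w1000 by auto
  have a: "0 < a" "a \<le> 4 * w" using a_eq lnw by auto
  have b: "w\<^sup>2 \<le> b"
  proof (rule power2_le_imp_le)
    show "(w\<^sup>2)\<^sup>2 \<le> b\<^sup>2" using k(2) by (simp add: kw b_def power_mult[symmetric])
    show "0 \<le> b" using n by (simp add: b_def)
  qed
  have ww: "1000 * w \<le> w\<^sup>2" using w1000 by (simp add: power2_eq_square mult_right_mono)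
  have ab: "a \<le> b / 2" using a b ww w1000 by linarith
  have "w ^ 3 / 4 = real k / (4 * w)" using w1000 by (simp add: kw eval_nat_numeral)
  also have "\<dots> \<le> real k / a" using a kpos by (intro divide_left_mono) auto
  finally have \<sigma>: "w ^ 3 / 4 - 1 \<le> \<sigma>" by (simp add: \<sigma>_def)
  have "1000 ^ 3 \<le> w ^ 3" using w1000 by (intro power_mono) auto
  then have w3: "1000 \<le> w ^ 3" by simp
  have "(2 + d / 2) * real k \<le> w / 16 * w ^ 4"
    unfolding kw using w d by (intro mult_right_mono) auto
  also have "\<dots> = w ^ 3 / 16 * w\<^sup>2" by (simp add: eval_nat_numeral)
  \<comment> \<open>The subtracted 2 reserves \<open>2 * b\<close>, which becomes the factor
    \<open>1 / n\<^sup>2\<close>.\<close>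
  also have "\<dots> \<le> (\<sigma> / 2 - 2) * b"
  proof (rule mult_mono)
    show "w ^ 3 / 16 \<le> \<sigma> / 2 - 2" using \<sigma> w3 by linarith
    show "0 \<le> \<sigma> / 2 - 2" using \<sigma> w3 by linarith
  qed (use b in auto)
  finally have main: "(2 + d / 2) * real k \<le> (\<sigma> / 2 - 2) * b" .
  have "\<sigma> * (a - b) \<le> \<sigma> * (- b / 2)"
    using ab \<sigma> w3 by (intro mult_left_mono) auto
  then have "(2 + d / 2) * real k + \<sigma> * (a - b) \<le> - 2 * b"
    using main by (simp add: algebra_simps)
  then have "exp ((2 + d / 2) * real k + \<sigma> * (a - b)) \<le> exp (- 2 * b)" by simp
  moreover have "(real k / real n) powr \<sigma> = exp (\<sigma> * (a - b))"
    using kpos n by (simp add: powr_def a_def b_def ln_div)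
  moreover have "exp (- 2 * b) = 1 / (real n)\<^sup>2"
    using n by (simp add: b_def exp_minus exp_double divide_inverse)
  ultimately show ?thesis by (simp add: \<sigma>_def a_def exp_add)
qed

text \<open>A factor \<open>r\<close> is kept because \<open>r \<le> sqrt d\<close> later supplies
  the dependence on \<open>d\<close>.\<close>

lemma sum_power_le:
  fixes r :: real
  assumes "0 \<le> r" "r \<le> 1 / 2"
  shows "(\<Sum>k=1..n. r ^ k) \<le> 2 * r"
proof -
  have "(\<Sum>k=1..n. r ^ k) = (\<Sum>i<n. r * r ^ i)"
    by (rule sum.reindex_bij_witness[of _ Suc "\<lambda>k. k - 1"]) (auto simp flip: power_Suc)
  also have "\<dots> \<le> (\<Sum>i<n. r * (1 / 2) ^ i)"
    using assms by (intro sum_mono mult_left_mono power_mono) auto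
  also have "\<dots> = r * (\<Sum>i<n. (1 / 2) ^ i)" by (simp add: sum_distrib_left)
  also have "\<dots> \<le> r * 2"
    using assms by (intro mult_left_mono) (simp_all add: geometric_sum)
  finally show ?thesis by simp
qed

section \<open>Choice of constants and union bound over subgraph sizes\<close>

theorem theorem3p1:
  fixes d :: real
  assumes "d > 0"
  shows "\<exists>c::real. \<forall>n::nat. n \<ge> 1 \<longrightarrow>
           measure_pmf.prob (G_nm n (nat \<lceil>d * (real n - 1) / 2\<rceil>))
             {E. \<not> mono_tiny c (S_class d) (\<lambda>x. (ln x)\<^sup>2) ({1..n}, E)}
           < 200 * sqrt (d / real n)"
proof -
  \<comment> \<open>\<open>D\<close> exceeds \<open>d\<close> by 2 to absorb the rounding up of the
    edge number. The constant \<open>c\<close> is chosen so that the tail bound for size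
    \<open>k\<close> is \<open>r ^ (2 * k)\<close>: one factor \<open>r ^ k\<close> yields
    \<open>1 / sqrt n\<close>, the other a geometric series of order \<open>sqrt d\<close>.\<close>
  define D where "D = d + 2"
  define r where "r = min (1 / 2) (sqrt d)"
  define c where "c = 8 * exp (1 + D / 2) / r\<^sup>2"
  have r: "0 < r" "r \<le> 1 / 2" "r \<le> sqrt d" using assms by (auto simp: r_def)
  have c: "c > 0" "8 * exp (1 + D / 2) / c = r\<^sup>2" using r by (simp_all add: c_def)
  have D: "D \<ge> 0" using assms by (simp add: D_def)
  have "measure_pmf.prob (G_nm n (nat \<lceil>d * (real n - 1) / 2\<rceil>))
      {E. \<not> mono_tiny c (S_class d) (\<lambda>x. (ln x)\<^sup>2) ({1..n}, E)} < 200 * sqrt (d / real n)"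
    if n: "n \<ge> 1" for n
  proof (cases "real n \<le> d")
    case True
    \<comment> \<open>There may be no graph with that many edges, so that \<open>G_nm\<close> is unspecified, but the bound is larger than 1.\<close>
    then have "1 \<le> sqrt (d / real n)" using n by simp
    then show ?thesis
      using measure_pmf.prob_le_1[of "G_nm n (nat \<lceil>d * (real n - 1) / 2\<rceil>)"
        "{E. \<not> mono_tiny c (S_class d) (\<lambda>x. (ln x)\<^sup>2) ({1..n}, E)}"] by linarith
  next
    case False
    define m where "m = nat \<lceil>d * (real n - 1) / 2\<rceil>"
    let ?P = "measure_pmf.prob (G_nm n m)"
    let ?N = "n choose 2"
    have N: "real ?N = real n * (real n - 1) / 2"
    proof -
      have "even (n * (n - 1))" by auto
      then have "real (n * (n - 1) div 2) = real (n * (n - 1)) / 2" by (simp only: real_of_nat_div of_nat_numeral)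
      then show ?thesis using n by (simp add: choose_two of_nat_diff)
    qed
    have "d * (real n - 1) / 2 \<le> real_of_int (int ?N)"
      using N False n by (simp add: mult_right_mono)
    then have m1: "m \<le> ?N" by (simp add: m_def ceiling_le_iff nat_le_iff)
    have m2: "real m \<le> D / real n * real ?N"
    \<comment> \<open>Absorbing the \<open>+ 1\<close> from the ceiling needs
      \<open>n - 1 \<ge> 1\<close>; for \<open>n = 1\<close> there are no edges.\<close>
    proof (cases "n = 1")
      case True
      then show ?thesis using D by (simp add: m_def)
    next
      case False
      then have "2 \<le> real n" using n by linarith
      have "0 \<le> d * (real n - 1) / 2" using assms n by simp
      then have "real m \<le> d * (real n - 1) / 2 + 1"
        unfolding m_def by linarith
      also have "\<dots> \<le> D * (real n - 1) / 2"
        using \<open>2 \<le> real n\<close> by (simp add: D_def field_simps)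
      also have "\<dots> = D / real n * real ?N" using n by (simp add: N)
      finally show ?thesis .
    qed
    let ?K1 = "{k \<in> {1..n}. 1000 powr (10 * (d + 1)) \<le> real k \<and> real k \<le> (ln (real n))\<^sup>2}"
    let ?K2 = "{k \<in> {1..n}. (ln (real n))\<^sup>2 < real k}"
    let ?B1 = "\<lambda>k. {E. \<exists>H\<in>subgraphs_k ({1..n}, E) k.
      real k + (real k / ln (real k) - 1) \<le> real (card (snd H))}"
    let ?B2 = "\<lambda>k. {E. c ^ k < real (s_k ({1..n}, E) k)}"
    \<comment> \<open>A subgraph outside \<open>S_class d\<close> contains a too dense subgraph of
      some size \<open>k' \<le> k\<close>, which is again a subgraph of the random graph. Hence only
      sizes in \<open>?K1\<close> need a density bound.\<close>
    have sub: "{E. \<not> mono_tiny c (S_class d) (\<lambda>x. (ln x)\<^sup>2) ({1..n}, E)} \<subseteq>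
        (\<Union>k\<in>?K1. ?B1 k) \<union> (\<Union>k\<in>?K2. ?B2 k)"
    proof
      fix E assume "E \<in> {E. \<not> mono_tiny c (S_class d) (\<lambda>x. (ln x)\<^sup>2) ({1..n}, E)}"
      then consider k H where "1 \<le> k" "real k \<le> (ln (real n))\<^sup>2" "H \<in> subgraphs_k ({1..n}, E) k" "\<not> S_class d H"
        | k where "(ln (real n))\<^sup>2 < real k" "k \<le> n" "\<not> real (s_k ({1..n}, E) k) \<le> c ^ k"
        by (auto simp: mono_tiny_def)
      then show "E \<in> (\<Union>k\<in>?K1. ?B1 k) \<union> (\<Union>k\<in>?K2. ?B2 k)"
      proof cases
        case 1
        have H: "fst H \<subseteq> {1..n}" "snd H \<subseteq> E" "card (fst H) = k"
          using 1(3) by (auto simp: subgraphs_k_def is_subgraph_def)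
        obtain k' H' where k': "1000 powr (10 * (d + 1)) \<le> real k'" "k' \<le> k"
          "H' \<in> subgraphs_k H k'" "\<not> real (card (snd H')) \<le> real k' - 1 + real k' / ln (real k')"
          using 1(4) H(3) unfolding S_class_def by blast
        have "H' \<in> subgraphs_k ({1..n}, E) k'"
          using k'(3) H by (auto simp: subgraphs_k_def is_subgraph_def)
        then have "E \<in> ?B1 k'" using k'(4) by force
        moreover have "k' \<in> ?K1"
        proof -
          have "(0::real) < 1000 powr (10 * (d + 1))" by simp
          then have "1 \<le> k'" using k'(1) by linarith
          moreover have "k \<le> n" using H card_mono[of "{1..n}" "fst H"] by simp
          moreover have "real k' \<le> (ln (real n))\<^sup>2" using 1(2) k'(2) by linarith
          ultimately show ?thesis using k'(1,2) by simp
        qed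
        ultimately show ?thesis by blast
      next
        case 2
        have "0 < real k" using 2(1) zero_le_power2[of "ln (real n)"] by linarith
        then have "k \<in> ?K2" "E \<in> ?B2 k" using 2 by auto
        then show ?thesis by blast
      qed
    qed
    have P1: "?P (\<Union>k\<in>?K1. ?B1 k) \<le> sqrt (d / real n)"
    \<comment> \<open>The union bound gives \<open>1 / n\<close>, which is below
      \<open>sqrt (d / n)\<close> once \<open>d * n > 1\<close>. Otherwise \<open>m \<le> 1\<close>,
      too few edges for any dense subgraph.\<close>
    proof (cases "d * real n \<le> 1")
      case True
      have "d * (real n - 1) / 2 \<le> 1" using True assms by (simp add: algebra_simps)
      then have m_le: "m \<le> 1" by (simp add: m_def ceiling_le_iff nat_le_iff)
      \<comment> \<open>The empty family turns the first moment bound into probability 0 for an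
        impossible event.\<close>
      have "?P (\<Union>k\<in>?K1. ?B1 k) \<le> (\<Sum>c\<in>({} :: (nat set \<times> nat set set) set). (D / real n) ^ card (snd c)) / 1"
      proof (rule prob_G_nm_le_first_moment)
        fix E assume E: "E \<in> (\<Union>k\<in>?K1. ?B1 k)" "E \<in> G_nm_space n m"
        then obtain k H where k: "1000 powr (10 * (d + 1)) \<le> real k"
          and H: "H \<in> subgraphs_k ({1..n}, E) k" "real k + (real k / ln (real k) - 1) \<le> real (card (snd H))"
          by blast
        have "1000 powr 1 \<le> 1000 powr (10 * (d + 1))" using assms by (intro powr_mono) auto
        then have "1000 \<le> real k" using k by simp
        moreover have "0 \<le> real k / ln (real k)" using calculation by simp
        ultimately have "1 < card (snd H)" using H(2) by linarith
        moreover have "finite E" "card E = m"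
          using E(2) finite_edges_on[of "{1..n}"] by (auto simp: G_nm_space_def intro: finite_subset)
        moreover have "snd H \<subseteq> E" using H(1) by (simp add: subgraphs_k_def is_subgraph_def)
        ultimately have False using card_mono[of E "snd H"] m_le by linarith
        then show "1 \<le> real (card {c \<in> {} :: (nat set \<times> nat set set) set. snd c \<subseteq> E})" ..
      qed (use D m1 m2 in auto)
      then show ?thesis using assms by (simp add: order_trans[OF _ real_sqrt_ge_zero])
    next
      case False
      have "?P (\<Union>k\<in>?K1. ?B1 k) \<le> (\<Sum>k\<in>?K1. ?P (?B1 k))"
        by (rule measure_UNION_le) auto
      also have "\<dots> \<le> (\<Sum>k\<in>?K1. 1 / (real n)\<^sup>2)"
      proof (rule sum_mono)
        fix k assume k: "k \<in> ?K1"
        have "?P (?B1 k) \<le> exp ((1 + D / 2) * real k) * (real k / real n) powr (real k / ln (real k) - 1)"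
          using k by (intro prob_dense_subgraph_le D m1 m2) auto
        also have "1 + D / 2 = 2 + d / 2" by (simp add: D_def)
        also have "exp ((2 + d / 2) * real k) * (real k / real n) powr (real k / ln (real k) - 1) \<le> 1 / (real n)\<^sup>2"
          using k assms n by (intro dense_subgraph_bound_le) auto
        finally show "?P (?B1 k) \<le> 1 / (real n)\<^sup>2" .
      qed
      also have "\<dots> \<le> (\<Sum>k=1..n. 1 / (real n)\<^sup>2)" by (rule sum_mono2) auto
      also have "\<dots> = 1 / real n" using n by (simp add: power2_eq_square)
      also have "\<dots> = sqrt ((1 / real n)\<^sup>2)" by simp
      also have "\<dots> \<le> sqrt (d / real n)"
        using False n by (simp only: real_sqrt_le_iff) (simp add: power2_eq_square field_simps)
      finally show ?thesis .
    qed
    have P2: "?P (\<Union>k\<in>?K2. ?B2 k) \<le> 2 * sqrt (d / real n)"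
    proof -
      have "?P (\<Union>k\<in>?K2. ?B2 k) \<le> (\<Sum>k\<in>?K2. ?P (?B2 k))"
        by (rule measure_UNION_le) auto
      also have "\<dots> \<le> (\<Sum>k\<in>?K2. r ^ k / sqrt (real n))"
      proof (rule sum_mono)
        fix k assume k: "k \<in> ?K2"
        have "?P (?B2 k) \<le> (8 * exp (1 + D / 2) / c) ^ k"
          using k by (intro prob_many_unlabelled_subgraphs_le D m1 m2 c) auto
        also have "\<dots> = r ^ k * r ^ k" by (simp add: c(2) power2_eq_square power_mult_distrib)
        also have "\<dots> \<le> r ^ k * (1 / sqrt (real n))"
        proof (rule mult_left_mono)
          \<comment> \<open>If \<open>ln n > 1\<close> then
            \<open>k > (ln n)\<^sup>2 \<ge> ln n\<close>; otherwise \<open>k \<ge> 1\<close>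
            suffices. With \<open>r \<le> exp (- 1 / 2)\<close> this gives the factor
            \<open>1 / sqrt n\<close>.\<close>
          have "ln (real n) \<le> real k"
          proof (cases "ln (real n) \<le> 1")
            case False
            then have "ln (real n) * 1 \<le> ln (real n) * ln (real n)" by (intro mult_left_mono) auto
            then show ?thesis using k by (simp add: power2_eq_square)
          qed (use k in auto)
          have "r \<le> exp (- 1 / 2)" using r exp_ge_add_one_self[of "- 1 / 2 :: real"] by simp
          then have "r ^ k \<le> exp (- 1 / 2) ^ k" using r by (intro power_mono) auto
          also have "\<dots> = exp (real k * (- 1 / 2))" by (rule exp_of_nat_mult[symmetric])
          also have "\<dots> \<le> exp (- ln (sqrt (real n)))"
            using \<open>ln (real n) \<le> real k\<close> n by (simp add: ln_sqrt)
          also have "\<dots> = 1 / sqrt (real n)" using n by (simp add: exp_minus divide_inverse)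
          finally show "r ^ k \<le> 1 / sqrt (real n)" .
        qed (use r in simp)
        finally show "?P (?B2 k) \<le> r ^ k / sqrt (real n)" by simp
      qed
      also have "\<dots> \<le> (\<Sum>k=1..n. r ^ k / sqrt (real n))"
        using r by (intro sum_mono2) auto
      also have "\<dots> = (\<Sum>k=1..n. r ^ k) / sqrt (real n)" by (simp add: sum_divide_distrib)
      also have "\<dots> \<le> 2 * sqrt d / sqrt (real n)"
        using sum_power_le[of r n] r by (intro divide_right_mono) auto
      finally show ?thesis by (simp add: real_sqrt_divide)
    qed
    have "?P {E. \<not> mono_tiny c (S_class d) (\<lambda>x. (ln x)\<^sup>2) ({1..n}, E)} \<le>
        ?P ((\<Union>k\<in>?K1. ?B1 k) \<union> (\<Union>k\<in>?K2. ?B2 k))"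
      by (rule measure_pmf.finite_measure_mono[OF sub]) simp
    also have "\<dots> \<le> ?P (\<Union>k\<in>?K1. ?B1 k) + ?P (\<Union>k\<in>?K2. ?B2 k)"
      by (rule measure_Un_le) auto
    also have "\<dots> \<le> 3 * sqrt (d / real n)" using P1 P2 by linarith
    also have "\<dots> < 200 * sqrt (d / real n)" using assms n by simp
    finally show ?thesis by (simp only: m_def)
  qed
  then show ?thesis by blast
qed

end
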